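(* Let $C$ be a commutative unital ring, $\kappa$ a nonzero cardinal, and $\mathrm{tr} : \mathbb{M}_\kappa (C) \to C$ the usual trace. Then a $C$-linear map $t : \mathbb{M}_\kappa (C) \to C$ is a trace if and only if there exists $c \in C$ such that $t(M) = c \cdot \mathrm{tr} (M)$ for all $M \in \mathbb{M}_\kappa (C)$. In this case, $t$ is minimal if and only if $c$ is not a zero divisor.
   Context: For a finite cardinal $\kappa=n$, $\mathbb{M}_\kappa(C)$ is the ring of $n\times n$ matrices over $C$; for infinite $\kappa$, $\mathbb{M}_\kappa(C)$ is the ring of matrices over $C$ with rows and columns indexed by $\kappa$ and with only finitely many nonzero entries. The usual trace is the sum of the diagonal entries. A map $t:A\to T$ between rings is a trace if $t(x+y)=t(x)+t(y)$ and $t(xy)=t(yx)$ for all $x,y\in A$; it is minimal if $t(x)=0$ implies $x\in[A,A]$, where $[A,A]$ is the additive subgroup of $A$ generated by all commutators $xy-yx$. "$c$ is not a zero divisor" means $ac\neq0$ for all $a\in C\setminus\{0\}$ (so $0$ counts as a zero divisor in a nonzero ring). *)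

theory Defs
  imports
    "HOL-Library.Groups_Big_Fun"
    "HOL-Computational_Algebra.Group_Closure"
begin

section \<open>Rings of finitely supported matrices\<close>

text \<open>
  A nonzero cardinal \<open>\<kappa>\<close> is represented by the index type \<open>'i\<close>, which may be finite or
  infinite (and is nonempty, as every type is). If \<open>'i\<close> is finite, the support condition is
  vacuous, so one type covers both the full rings of \<open>n \<times> n\<close> matrices and the
  (non-unital) rings for infinite \<open>\<kappa>\<close>.
\<close>

typedef (overloaded) ('i, 'c) fmat =
    "{M :: 'i \<Rightarrow> 'i \<Rightarrow> 'c::zero. finite {(i, j). M i j \<noteq> 0}}"
  morphisms entry Abs_fmat
  by (rule exI[of _ "\<lambda>_ _. 0"]) simp

setup_lifting type_definition_fmat

lemma fmat_eqI: "(\<And>i j. entry M i j = entry N i j) \<Longrightarrow> M = N"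
  by transfer (simp add: fun_eq_iff)

lemma finite_support_fmat: "finite {(i, j). entry M i j \<noteq> 0}"
  by transfer

lemma entry_Abs_fmat_finite:
  fixes f :: "'i::finite \<Rightarrow> 'i \<Rightarrow> 'c::zero"
  shows "entry (Abs_fmat f) = f"
  by (rule Abs_fmat_inverse) simp

definition indices :: "('i, 'c::zero) fmat \<Rightarrow> 'i set"
  where "indices M = fst ` {(i, j). entry M i j \<noteq> 0} \<union> snd ` {(i, j). entry M i j \<noteq> 0}"

lemma finite_indices: "finite (indices M)"
  unfolding indices_def by (intro finite_UnI finite_imageI finite_support_fmat)

lemma entry_outside:
  "i \<notin> indices M \<Longrightarrow> entry M i j = 0" "j \<notin> indices M \<Longrightarrow> entry M i j = 0"
  unfolding indices_def by force+

instantiation fmat :: (type, zero) zero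
begin
lift_definition zero_fmat :: "('a, 'b) fmat" is "\<lambda>_ _. 0" by simp
instance ..
end

instantiation fmat :: (type, ab_group_add) ab_group_add
begin

lift_definition plus_fmat :: "('a, 'b) fmat \<Rightarrow> ('a, 'b) fmat \<Rightarrow> ('a, 'b) fmat"
  is "\<lambda>M N i j. M i j + N i j"
proof -
  fix M N :: "'a \<Rightarrow> 'a \<Rightarrow> 'b"
  assume "finite {(i, j). M i j \<noteq> 0}" "finite {(i, j). N i j \<noteq> 0}"
  then have "finite ({(i, j). M i j \<noteq> 0} \<union> {(i, j). N i j \<noteq> 0})" by simp
  then show "finite {(i, j). M i j + N i j \<noteq> 0}" by (rule rev_finite_subset) auto
qed

lift_definition uminus_fmat :: "('a, 'b) fmat \<Rightarrow> ('a, 'b) fmat"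
  is "\<lambda>M i j. - M i j" by simp

definition minus_fmat :: "('a, 'b) fmat \<Rightarrow> ('a, 'b) fmat \<Rightarrow> ('a, 'b) fmat"
  where "M - N = M + - N" for M N :: "('a, 'b) fmat"

instance
  by standard (unfold minus_fmat_def, (transfer, simp add: fun_eq_iff algebra_simps)+)

end

instantiation fmat :: (type, ring) ring
begin

lift_definition times_fmat :: "('a, 'b) fmat \<Rightarrow> ('a, 'b) fmat \<Rightarrow> ('a, 'b) fmat"
  is "\<lambda>M N i j. Sum_any (\<lambda>k. M i k * N k j)"
proof -
  fix M N :: "'a \<Rightarrow> 'a \<Rightarrow> 'b"
  assume fin: "finite {(i, j). M i j \<noteq> 0}" "finite {(i, j). N i j \<noteq> 0}"
  have "finite (fst ` {(i, j). M i j \<noteq> 0} \<times> snd ` {(i, j). N i j \<noteq> 0})"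
    using fin by simp
  moreover have "(i, j) \<in> fst ` {(i, j). M i j \<noteq> 0} \<times> snd ` {(i, j). N i j \<noteq> 0}"
    if nonzero: "Sum_any (\<lambda>k. M i k * N k j) \<noteq> 0" for i j
  proof -
    obtain k where "M i k * N k j \<noteq> 0"
      using nonzero by (rule Sum_any.not_neutral_obtains_not_neutral)
    then have "M i k \<noteq> 0" "N k j \<noteq> 0" by auto
    then show ?thesis by force
  qed
  then have "{(i, j). Sum_any (\<lambda>k. M i k * N k j) \<noteq> 0}
      \<subseteq> fst ` {(i, j). M i j \<noteq> 0} \<times> snd ` {(i, j). N i j \<noteq> 0}"
    by blast
  ultimately show "finite {(i, j). Sum_any (\<lambda>k. M i k * N k j) \<noteq> 0}"
    by (rule rev_finite_subset)
qed

lemma entry_times_sum: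
  fixes M N :: "('a, 'b) fmat"
  assumes "finite S" "indices M \<subseteq> S \<or> indices N \<subseteq> S"
  shows "entry (M * N) i j = (\<Sum>k\<in>S. entry M i k * entry N k j)"
  unfolding times_fmat.rep_eq
proof (rule Sum_any.expand_superset)
  show "{k. entry M i k * entry N k j \<noteq> 0} \<subseteq> S"
  proof
    fix k assume "k \<in> {k. entry M i k * entry N k j \<noteq> 0}"
    then have "entry M i k \<noteq> 0" "entry N k j \<noteq> 0" by auto
    then show "k \<in> S" using assms(2) entry_outside by (metis subsetD)
  qed
qed (rule assms(1))

instance
proof
  fix M N P :: "('a, 'b) fmat"
  define S where "S = indices M \<union> indices N \<union> indices P"
  have S: "finite S" "indices M \<subseteq> S" "indices N \<subseteq> S" "indices P \<subseteq> S"
    unfolding S_def using finite_indices by auto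
  note prod = entry_times_sum[OF S(1)]
  show "M * N * P = M * (N * P)"
    by (rule fmat_eqI)
       (simp add: prod S sum_distrib_left sum_distrib_right mult.assoc, rule sum.swap)
  show "(M + N) * P = M * P + N * P" "M * (N + P) = M * N + M * P"
    by (rule fmat_eqI, simp add: prod S plus_fmat.rep_eq algebra_simps sum.distrib)+
qed

end

lift_definition scalar_mult :: "'c::mult_zero \<Rightarrow> ('i, 'c) fmat \<Rightarrow> ('i, 'c) fmat"
  is "\<lambda>c M i j. c * M i j"
  by (rule rev_finite_subset, assumption) auto

definition matrix_trace :: "('i, 'c::comm_monoid_add) fmat \<Rightarrow> 'c"
  where "matrix_trace M = Sum_any (\<lambda>i. entry M i i)"


section \<open>Traces\<close>

text \<open>The class \<^class>\<open>ring\<close> does not require a unit.\<close>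

definition commutator_subgroup :: "'a::ring set"
  where "commutator_subgroup = group_closure {x * y - y * x | x y. True}"

definition is_trace :: "('a::ring \<Rightarrow> 'b::ring) \<Rightarrow> bool"
  where "is_trace t \<longleftrightarrow>
    (\<forall>x y. t (x + y) = t x + t y) \<and> (\<forall>x y. t (x * y) = t (y * x))"

definition is_minimal_trace :: "('a::ring \<Rightarrow> 'b::ring) \<Rightarrow> bool"
  where "is_minimal_trace t \<longleftrightarrow>
    is_trace t \<and> (\<forall>x. t x = 0 \<longrightarrow> x \<in> commutator_subgroup)"

text \<open>
  The sort \<open>{comm_ring, comm_monoid_mult}\<close> is that of commutative unital rings
  including the zero ring, which \<^class>\<open>comm_ring_1\<close> excludes.
\<close>

definition linear_map ::
    "(('i, 'c::{comm_ring, comm_monoid_mult}) fmat \<Rightarrow> 'c) \<Rightarrow> bool"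
  where "linear_map t \<longleftrightarrow>
    (\<forall>M N. t (M + N) = t M + t N) \<and> (\<forall>a M. t (scalar_mult a M) = a * t M)"

text \<open>With this convention, \<open>0\<close> is a zero divisor in every nonzero ring.\<close>

definition zero_divisor :: "'c::comm_ring \<Rightarrow> bool"
  where "zero_divisor c \<longleftrightarrow> (\<exists>a. a \<noteq> 0 \<and> a * c = 0)"

end

theory Submission
  imports Defs
begin

text \<open>
  Modulo commutators every matrix unit \<open>a E\<^sub>i\<^sub>j\<close> with \<open>i \<noteq> j\<close> vanishes, and \<open>a E\<^sub>i\<^sub>i\<close> agrees with
  \<open>a E\<^sub>k\<^sub>k\<close> for any fixed index \<open>k\<close>. Hence \<open>M\<close> is congruent to \<open>tr(M) E\<^sub>k\<^sub>k\<close>. Since traces vanish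
  on commutators, this determines every linear trace by its value at \<open>E\<^sub>k\<^sub>k\<close>, and shows that the
  kernel of the usual trace is exactly the commutator subgroup.
\<close>

lift_definition single_entry :: "'i \<Rightarrow> 'i \<Rightarrow> 'c::zero \<Rightarrow> ('i, 'c) fmat"
  is "\<lambda>i j a k l. if k = i \<and> l = j then a else 0"
  by (rule finite_subset[of _ "{(i, j)}" for i j]) (auto split: if_splits)

lemma indices_subset:
  "(\<And>i j. entry M i j \<noteq> 0 \<Longrightarrow> i \<in> S \<and> j \<in> S) \<Longrightarrow> indices M \<subseteq> S"
  unfolding indices_def by auto

lemma entry_outside_superset:
  assumes "indices M \<subseteq> S" "i \<notin> S \<or> j \<notin> S"
  shows "entry M i j = 0"
  using assms entry_outside by (metis subsetD)

lemma single_entry_zero [simp]: "single_entry i j 0 = 0"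
  by transfer (simp add: fun_eq_iff)

lemma single_entry_add: "single_entry i j (a + b) = single_entry i j a + single_entry i j b"
  by transfer (auto simp: fun_eq_iff)

lemma single_entry_sum: "single_entry i j (sum f S) = (\<Sum>x\<in>S. single_entry i j (f x))"
  by (induction S rule: infinite_finite_induct) (simp_all add: single_entry_add)

lemma entry_zero [simp]: "entry 0 i j = 0"
  by transfer simp

lemma entry_sum: "entry (sum f S) i j = (\<Sum>x\<in>S. entry (f x) i j)"
  by (induction S rule: infinite_finite_induct) (simp_all add: plus_fmat.rep_eq)

lemma single_entry_times:
  fixes a b :: "'c::ring"
  shows "single_entry i j a * single_entry k l b =
    (if j = k then single_entry i l (a * b) else 0)"
proof (rule fmat_eqI)
  fix p q
  have "indices (single_entry i j a) \<subseteq> {i, j}"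
    by (rule indices_subset) (simp add: single_entry.rep_eq split: if_splits)
  then show "entry (single_entry i j a * single_entry k l b) p q =
      entry (if j = k then single_entry i l (a * b) else 0) p q"
    by (subst entry_times_sum[of "{i, j}"])
       (auto simp: single_entry.rep_eq sum.insert_if)
qed

lemma scalar_mult_single_entry: "scalar_mult c (single_entry i j a) = single_entry i j (c * a)"
  by transfer (simp add: fun_eq_iff)

text \<open>Each position inside \<open>S \<times> S\<close> receives exactly one summand, and all
  positions outside it carry the entry 0.\<close>

lemma fmat_eq_sum_single_entry:
  fixes M :: "('i, 'c::ab_group_add) fmat"
  assumes "finite S" "indices M \<subseteq> S"
  shows "M = (\<Sum>(i, j)\<in>S \<times> S. single_entry i j (entry M i j))"
proof (rule fmat_eqI)
  fix p q
  have "(\<Sum>(i, j)\<in>S \<times> S. entry (single_entry i j (entry M i j)) p q) =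
      (\<Sum>x\<in>S \<times> S. if x = (p, q) then entry M p q else 0)"
    by (rule sum.cong) (auto simp: single_entry.rep_eq split: if_splits)
  also have "\<dots> = entry M p q"
    using assms(1) entry_outside_superset[OF assms(2), of p q] by auto
  finally show "entry M p q = entry (\<Sum>(i, j)\<in>S \<times> S. single_entry i j (entry M i j)) p q"
    by (simp add: entry_sum case_prod_unfold)
qed

text \<open>Allowing any finite superset \<open>S\<close> of the indices lets the traces of several
  matrices be compared over one common range.\<close>

lemma matrix_trace_eq_sum:
  assumes "finite S" "indices M \<subseteq> S"
  shows "matrix_trace M = (\<Sum>i\<in>S. entry M i i)"
  unfolding matrix_trace_def
  using assms entry_outside[of _ M] by (intro Sum_any.expand_superset) auto

lemma matrix_trace_single_entry: "matrix_trace (single_entry i i a) = a"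
proof -
  have "indices (single_entry i i a) \<subseteq> {i}"
    by (rule indices_subset) (simp add: single_entry.rep_eq split: if_splits)
  then show ?thesis
    by (simp add: matrix_trace_eq_sum[of "{i}"] single_entry.rep_eq)
qed

text \<open>Over a common finite index set, both \<open>tr(M N)\<close> and \<open>tr(N M)\<close>
  are finite double sums of the same products, matched by swapping the summation order and by
  commutativity of the coefficients.\<close>

lemma is_trace_matrix_trace:
  "is_trace (matrix_trace :: ('i, 'c::comm_ring) fmat \<Rightarrow> 'c)"
  unfolding is_trace_def
proof (intro conjI allI)
  fix M N :: "('i, 'c) fmat"
  define S where "S = indices M \<union> indices N"
  have S: "finite S" "indices M \<subseteq> S" "indices N \<subseteq> S"
    by (auto simp: S_def finite_indices)
  note outside = entry_outside_superset[OF S(2)] entry_outside_superset[OF S(3)]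
  \<comment> \<open>A row or column index outside \<open>S\<close> makes every term of the sum or
    product entry vanish.\<close>
  have sub: "indices (M + N) \<subseteq> S" "indices (M * N) \<subseteq> S" "indices (N * M) \<subseteq> S"
    by (rule indices_subset, rule ccontr,
        force simp: plus_fmat.rep_eq entry_times_sum[OF S(1)] S outside)+
  show "matrix_trace (M + N) = matrix_trace M + matrix_trace N"
    by (simp add: matrix_trace_eq_sum[OF S(1)] S sub plus_fmat.rep_eq sum.distrib)
  show "matrix_trace (M * N) = matrix_trace (N * M)"
    by (simp add: matrix_trace_eq_sum[OF S(1)] S sub entry_times_sum[OF S(1)])
       (subst sum.swap, simp add: mult.commute)
qed

lemma is_trace_scaled:
  assumes "is_trace t"
  shows "is_trace (\<lambda>x. c * t x)"
  using assms by (simp add: is_trace_def distrib_left)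

lemma trace_zero: "is_trace t \<Longrightarrow> t 0 = 0"
  unfolding is_trace_def by (metis add.right_neutral add_left_cancel)

lemma trace_diff: "is_trace t \<Longrightarrow> t (x - y) = t x - t y"
  unfolding is_trace_def by (metis add_diff_cancel diff_add_cancel)

text \<open>The kernel of \<open>t\<close> is an additive subgroup, and it contains each commutator
  by the trace identity.\<close>

lemma trace_commutator_subgroup:
  assumes "is_trace t" "x \<in> commutator_subgroup"
  shows "t x = 0"
  using assms(2) unfolding commutator_subgroup_def
proof (induction rule: group_closure.induct)
  case base
  then show ?case using assms(1) by (auto simp: trace_zero trace_diff) (simp add: is_trace_def)
qed (use assms(1) in \<open>auto simp: trace_zero trace_diff\<close>)

lemma commutator_in_commutator_subgroup: "x * y - y * x \<in> commutator_subgroup"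
  unfolding commutator_subgroup_def by (rule group_closure.base) auto

text \<open>Explicit commutators do it: \<open>[a E\<^sub>i\<^sub>k, E\<^sub>k\<^sub>i] = a
  E\<^sub>i\<^sub>i - a E\<^sub>k\<^sub>k\<close>, and
  \<open>[E\<^sub>i\<^sub>i, a E\<^sub>i\<^sub>j] = a E\<^sub>i\<^sub>j\<close> for
  \<open>i \<noteq> j\<close>. The conditional merges both cases, so that the congruence can be
  summed over all entries of a matrix.\<close>

lemma single_entry_cong_diagonal:
  fixes a :: "'c::{comm_ring, comm_monoid_mult}"
  shows "single_entry i j a - single_entry k k (if i = j then a else 0) \<in> commutator_subgroup"
proof (cases "i = j")
  case True
  then show ?thesis
    using commutator_in_commutator_subgroup[of "single_entry i k a" "single_entry k i 1"]
    by (simp add: single_entry_times)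
next
  case False
  then show ?thesis
    using commutator_in_commutator_subgroup[of "single_entry i i 1" "single_entry i j a"]
    by (simp add: single_entry_times)
qed

lemma sum_in_commutator_subgroup:
  "(\<And>x. x \<in> S \<Longrightarrow> f x \<in> commutator_subgroup) \<Longrightarrow> sum f S \<in> commutator_subgroup"
  unfolding commutator_subgroup_def
  by (induction S rule: infinite_finite_induct) (auto intro: group_closure.intros group_closure_add)

lemma cong_matrix_trace:
  fixes M :: "('i, 'c::{comm_ring, comm_monoid_mult}) fmat"
  shows "M - single_entry k k (matrix_trace M) \<in> commutator_subgroup"
proof -
  let ?S = "indices M"
  let ?d = "\<lambda>i j. if i = j then entry M i j else 0"
  \<comment> \<open>Padding the diagonal sum with zeros to the whole square aligns it term by term
    with the expansion of \<open>M\<close> into matrix units.\<close>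
  have "matrix_trace M = (\<Sum>(i, j)\<in>?S \<times> ?S. ?d i j)"
    by (simp add: matrix_trace_eq_sum finite_indices flip: sum.cartesian_product)
  then have "M - single_entry k k (matrix_trace M) =
      (\<Sum>(i, j)\<in>?S \<times> ?S. single_entry i j (entry M i j) - single_entry k k (?d i j))"
    using fmat_eq_sum_single_entry[OF finite_indices subset_refl, of M]
    by (simp add: single_entry_sum case_prod_unfold sum_subtractf)
  also have "\<dots> \<in> commutator_subgroup"
    by (intro sum_in_commutator_subgroup) (auto simp only: split: prod.split intro: single_entry_cong_diagonal)
  finally show ?thesis .
qed

theorem corollary14:
  fixes t :: "('i, 'c::{comm_ring, comm_monoid_mult}) fmat \<Rightarrow> 'c"
  assumes "linear_map t"
  shows "(is_trace t \<longleftrightarrow> (\<exists>c. \<forall>M. t M = c * matrix_trace M)) \<and>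
    (\<forall>c. (\<forall>M. t M = c * matrix_trace M) \<longrightarrow>
      (is_minimal_trace t \<longleftrightarrow> \<not> zero_divisor c))"
proof -
  \<comment> \<open>An index exists because types are nonempty; this is the assumption that \<kappa>
    is nonzero.\<close>
  fix k :: 'i
  have multiple_trace: "is_trace t" if "\<forall>M. t M = c * matrix_trace M" for c
  proof -
    have "t = (\<lambda>M. c * matrix_trace M)" using that by auto
    then show ?thesis by (simp add: is_trace_scaled is_trace_matrix_trace)
  qed
  \<comment> \<open>The constant \<open>c\<close> is the value of \<open>t\<close> at
    \<open>E\<^sub>k\<^sub>k\<close>.\<close>
  have "t M = t (single_entry k k 1) * matrix_trace M" if tr: "is_trace t" for M
  proof -
    have "t M = t (single_entry k k (matrix_trace M))"
      using trace_commutator_subgroup[OF tr cong_matrix_trace[of M k]] trace_diff[OF tr] by simp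
    also have "\<dots> = t (scalar_mult (matrix_trace M) (single_entry k k 1))"
      by (simp add: scalar_mult_single_entry)
    also have "\<dots> = t (single_entry k k 1) * matrix_trace M"
      using assms by (simp add: linear_map_def mult.commute)
    finally show ?thesis .
  qed
  then have "is_trace t \<longleftrightarrow> (\<exists>c. \<forall>M. t M = c * matrix_trace M)"
    using multiple_trace by blast
  moreover have "is_minimal_trace t \<longleftrightarrow> \<not> zero_divisor c"
    if c: "\<forall>M. t M = c * matrix_trace M" for c
  proof
    assume minimal: "is_minimal_trace t"
    \<comment> \<open>The test matrix is \<open>a E\<^sub>k\<^sub>k\<close>: \<open>t\<close> sends
      it to \<open>c * a = 0\<close>, so minimality makes it a sum of commutators up to sign, and
      its usual trace \<open>a\<close> must vanish.\<close>
    have "a = 0" if "a * c = 0" for a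
    proof -
      have "t (single_entry k k a) = 0"
        using c that by (simp add: matrix_trace_single_entry mult.commute)
      then have "single_entry k k a \<in> commutator_subgroup"
        using minimal by (simp add: is_minimal_trace_def)
      then show ?thesis
        using trace_commutator_subgroup[OF is_trace_matrix_trace] matrix_trace_single_entry by metis
    qed
    then show "\<not> zero_divisor c" by (auto simp: zero_divisor_def)
  next
    assume "\<not> zero_divisor c"
    \<comment> \<open>Cancelling \<open>c\<close> reduces the kernel of \<open>t\<close> to that of
      the usual trace, where \<open>M\<close> is congruent to \<open>0 E\<^sub>k\<^sub>k = 0\<close>
      modulo commutators.\<close>
    then have "matrix_trace M = 0" if "t M = 0" for M
      using c that by (metis zero_divisor_def mult.commute)
    then have "M \<in> commutator_subgroup" if "t M = 0" for M
      using cong_matrix_trace[of M k] that by simp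
    then show "is_minimal_trace t"
      using multiple_trace[OF c] by (simp add: is_minimal_trace_def)
  qed
  ultimately show ?thesis by blast
qed

end
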